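(* Let $X,Y$ be sets, $0\in X$ a distinguished element, and let $\mathcal{A}=(R,Q,E,\rho,\xi,\rhd)$ be an approximation algorithm of sort $X^\ast,X,Y$ which terminates. Let $\mathcal{F}_1$ be the set of all $\phi:X^{\mathbb{N}}\to\mathbb{N}$ such that for every $\gamma\in X^{\mathbb{N}}$ there is $N\in\mathbb{N}$ with $\phi(\overline{\gamma}N::\mathbf{0})<N$. Then for every $\phi_1\in\mathcal{F}_1$ and every $\phi_2:X^{\mathbb{N}}\to Y$, some end state of $\mathcal{A}_\omega$ is reachable in $\mathcal{A}_\omega$ on $\phi_1,\phi_2$ (i.e. $\mathcal{A}_\omega$ terminates on $\mathcal{F}_1$ and the full function space $X^{\mathbb{N}}\to Y$).
   Context: Notation: for a set $Z$, $Z^\ast$ is the set of finite sequences over $Z$, $[\,]$ the empty sequence, $|a|$ the length of $a$, $a::z$ (resp. $a::b$) extension by an element (resp. concatenation); for $\alpha\in Z^{\mathbb{N}}$, $\overline{\alpha}n:=[\alpha_0,\dots,\alpha_{n-1}]$; $\mathbf{0}$ is the constant sequence $0,0,\dots$. Approximation algorithm of sort $U,X,Y$: a tuple $(R,Q,E,\rho,\xi,\rhd)$ where $R$ is a set; states are pairs $\langle r\mid o\rangle$ with $r\in R$, $o\in Y\cup\{\Box\}$ ($\Box$ a fresh symbol); $Q\subseteq\{\langle r\mid\Box\rangle\}$ (query states); $E\subseteq\{\langle r\mid y\rangle: y\in Y\}$ (end states), $Q\cap E=\emptyset$; $\rho:U\to R$; $\xi:R\to X$; $\rhd$ a partial function on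 states such that if $\rhd(\langle r\mid o\rangle)=\langle r'\mid y\rangle$ with $y\in Y$ then $o=y$ and $\xi(r)=\xi(r')$. For an oracle $f:X\to Y$, a run on $f$ is a finite sequence $s_0,\dots,s_m$ with $s_i\notin E$ for $i<m$, $s_{i+1}=\langle r\mid f(\xi(r))\rangle$ if $s_i=\langle r\mid\Box\rangle\in Q$, and $s_{i+1}=\rhd(s_i)$ (defined) if $s_i\notin Q$. $\mathcal{A}$ terminates if for every $u\in U$ and every $f:X\to Y$ there is a run on $f$ from $\langle\rho(u)\mid\Box\rangle$ to a state in $E$. Construction of $\mathcal{A}_\omega$: states $\langle\sigma,a\mid o_1,o_2\rangle$ with $\sigma\in R^\ast$, $a\in X^\ast$, $o_1\in\mathbb{N}\cup\{\Box\}$, $o_2\in Y\cup\{\Box\}$; initial state $\langle[\rho([\,])],[\,]\mid\Box,\Box\rangle$; $Q_1$: states $\langle\sigma::r,[\,]\mid\Box,\Box\rangle$ with $\langle r\mid\Box\rangle\in Q$; $Q_2$: states $\langle\sigma,[\,]\mid n,\Box\rangle$ with $n\in\mathbb{N}$, $n<|\sigma|$; end states $E_\omega$: $\langle[\,],a\mid n,y\rangle$ with $n\in\mathbb{N},y\in Y$. $\xi^\ast$ applies $\xi$ componentwise and $\xi_\omega(\sigma,a):=\xi^\ast(\sigma)::a::\mathbf{0}$. Transitions $\rhd_\omega$: (a) $\langle\sigma,[\,]\mid n,\Box\rangle\rhd_\omega\langle\sigma::\rho(\xi^\ast(\sigma)),[\,]\mid\Box,\Box\rangle$ for $n\in\mathbb{N}$;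 (b) $\langle\sigma::r,a\mid n,y\rangle\rhd_\omega\langle\sigma,\xi(r)::a\mid n,y\rangle$ if $\langle r\mid y\rangle\in E$; (c) otherwise: (i) $\langle\sigma::r,[\,]\mid\Box,\Box\rangle\rhd_\omega\langle\sigma::r',[\,]\mid\Box,\Box\rangle$ if $\rhd(\langle r\mid\Box\rangle)=\langle r'\mid\Box\rangle$; (ii) $\langle\sigma::r,a\mid n,y\rangle\rhd_\omega\langle\sigma::r',[\,]\mid\Box,\Box\rangle$ if $\rhd(\langle r\mid y\rangle)=\langle r'\mid\Box\rangle$; (iii) $\langle\sigma::r,a\mid n,y\rangle\rhd_\omega\langle\sigma::r',a\mid n,y\rangle$ if $\rhd(\langle r\mid y\rangle)=\langle r'\mid y\rangle$. With oracles $\phi_1:X^{\mathbb{N}}\to\mathbb{N}$, $\phi_2:X^{\mathbb{N}}\to Y$, a state in $Q_1$ moves from $\langle\sigma,a\mid\Box,\Box\rangle$ to $\langle\sigma,a\mid\phi_1(\xi_\omega(\sigma,a)),\Box\rangle$, and a state in $Q_2$ moves from $\langle\sigma,a\mid n,\Box\rangle$ to $\langle\sigma,a\mid n,\phi_2(\xi_\omega(\sigma,a))\rangle$; all other states move by $\rhd_\omega$. A run is a finite sequence of such moves not passing through $E_\omega$ before its last element; a state is reachable if it is the last element of a run from the initial state. *)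

theory Defs
  imports Main "HOL-Library.Omega_Words_Fun"
begin

text \<open>
  Sequences in $X^{\mathbb{N}}$ are \<open>'x word = nat \<Rightarrow> 'x\<close>, with \<open>w \<frown> \<alpha>\<close> for a finite
  sequence followed by an infinite one and \<open>prefix n \<alpha>\<close> for the list of the first \<open>n\<close> entries.
  The sets $X$, $Y$, $R$, $U$ are types.  The fresh symbol $\Box$ is \<^const>\<open>None\<close>.
  Finite sequences are extended on the right, so $\sigma{::}r$ is \<open>\<sigma> @ [r]\<close>.
\<close>

type_synonym ('r, 'y) state = "'r \<times> 'y option"

record ('u, 'x, 'y, 'r) algorithm =
  query_states :: "('r, 'y) state set"
  end_states :: "('r, 'y) state set"
  init :: "'u \<Rightarrow> 'r"
  query_arg :: "'r \<Rightarrow> 'x"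
  trans_fun :: "('r, 'y) state \<rightharpoonup> ('r, 'y) state"

definition approximation_algorithm :: "('u, 'x, 'y, 'r) algorithm \<Rightarrow> bool" where
  "approximation_algorithm A \<longleftrightarrow>
     query_states A \<subseteq> {(r, None) |r. True} \<and>
     end_states A \<subseteq> {(r, Some y) |r y. True} \<and>
     query_states A \<inter> end_states A = {} \<and>
     (\<forall>r oo r' y. trans_fun A (r, oo) = Some (r', Some y) \<longrightarrow>
        oo = Some y \<and> query_arg A r = query_arg A r')"

definition run :: "('s \<Rightarrow> 's \<Rightarrow> bool) \<Rightarrow> 's set \<Rightarrow> 's list \<Rightarrow> bool" where
  "run move F ss \<longleftrightarrow> ss \<noteq> [] \<and>
     (\<forall>i. Suc i < length ss \<longrightarrow> ss ! i \<notin> F \<and> move (ss ! i) (ss ! Suc i))"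

definition reachable :: "('s \<Rightarrow> 's \<Rightarrow> bool) \<Rightarrow> 's set \<Rightarrow> 's \<Rightarrow> 's \<Rightarrow> bool" where
  "reachable move F s t \<longleftrightarrow> (\<exists>ss. run move F ss \<and> hd ss = s \<and> last ss = t)"

inductive move :: "('u, 'x, 'y, 'r) algorithm \<Rightarrow> ('x \<Rightarrow> 'y) \<Rightarrow>
    ('r, 'y) state \<Rightarrow> ('r, 'y) state \<Rightarrow> bool"
  for A :: "('u, 'x, 'y, 'r) algorithm" and f :: "'x \<Rightarrow> 'y" where
  query: "(r, None) \<in> query_states A \<Longrightarrow> move A f (r, None) (r, Some (f (query_arg A r)))"
| trans: "s \<notin> query_states A \<Longrightarrow> trans_fun A s = Some s' \<Longrightarrow> move A f s s'"

definition terminates :: "('u, 'x, 'y, 'r) algorithm \<Rightarrow> bool" where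
  "terminates A \<longleftrightarrow>
     (\<forall>u f. \<exists>t\<in>end_states A. reachable (move A f) (end_states A) (init A u, None) t)"


type_synonym ('x, 'y, 'r) omega_state = "'r list \<times> 'x list \<times> nat option \<times> 'y option"

definition omega_init :: "('x list, 'x, 'y, 'r) algorithm \<Rightarrow> ('x, 'y, 'r) omega_state" where
  "omega_init A = ([init A []], [], None, None)"

definition omega_query1 :: "('x list, 'x, 'y, 'r) algorithm \<Rightarrow> ('x, 'y, 'r) omega_state set" where
  "omega_query1 A = {(\<sigma> @ [r], [], None, None) |\<sigma> r. (r, None) \<in> query_states A}"

definition omega_query2 :: "('x, 'y, 'r) omega_state set" where
  "omega_query2 = {(\<sigma>, [], Some n, None) |\<sigma> n. n < length \<sigma>}"

definition omega_end :: "('x, 'y, 'r) omega_state set" where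
  "omega_end = {([], a, Some n, Some y) |a n y. True}"

definition omega_query_arg ::
    "('x list, 'x, 'y, 'r) algorithm \<Rightarrow> 'x \<Rightarrow> 'r list \<Rightarrow> 'x list \<Rightarrow> 'x word" where
  "omega_query_arg A z \<sigma> a = (map (query_arg A) \<sigma> @ a) \<frown> (\<lambda>_. z)"

text \<open>
  The relation $\rhd_\omega$; it is a partial function, see \<open>omega_trans_functional\<close> below.
  The premises on non-membership in \<^const>\<open>end_states\<close> express that the
  last group of rules applies only where \<open>return\<close> does not.
\<close>

inductive omega_trans :: "('x list, 'x, 'y, 'r) algorithm \<Rightarrow>
    ('x, 'y, 'r) omega_state \<Rightarrow> ('x, 'y, 'r) omega_state \<Rightarrow> bool"
  for A :: "('x list, 'x, 'y, 'r) algorithm" where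
  call:
    "omega_trans A (\<sigma>, [], Some n, None)
       (\<sigma> @ [init A (map (query_arg A) \<sigma>)], [], None, None)"
| return:
    "(r, Some y) \<in> end_states A \<Longrightarrow>
     omega_trans A (\<sigma> @ [r], a, Some n, Some y) (\<sigma>, query_arg A r # a, Some n, Some y)"
| step_open:
    "trans_fun A (r, None) = Some (r', None) \<Longrightarrow>
     omega_trans A (\<sigma> @ [r], [], None, None) (\<sigma> @ [r'], [], None, None)"
| step_reset:
    "(r, Some y) \<notin> end_states A \<Longrightarrow> trans_fun A (r, Some y) = Some (r', None) \<Longrightarrow>
     omega_trans A (\<sigma> @ [r], a, Some n, Some y) (\<sigma> @ [r'], [], None, None)"
| step_closed:
    "(r, Some y) \<notin> end_states A \<Longrightarrow> trans_fun A (r, Some y) = Some (r', Some y) \<Longrightarrow>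
     omega_trans A (\<sigma> @ [r], a, Some n, Some y) (\<sigma> @ [r'], a, Some n, Some y)"

lemma omega_trans_functional:
  "omega_trans A s t \<Longrightarrow> omega_trans A s t' \<Longrightarrow> t = t'"
  by (elim omega_trans.cases) auto

inductive omega_move :: "('x list, 'x, 'y, 'r) algorithm \<Rightarrow> 'x \<Rightarrow>
    ('x word \<Rightarrow> nat) \<Rightarrow> ('x word \<Rightarrow> 'y) \<Rightarrow>
    ('x, 'y, 'r) omega_state \<Rightarrow> ('x, 'y, 'r) omega_state \<Rightarrow> bool"
  for A :: "('x list, 'x, 'y, 'r) algorithm" and z :: 'x
  and \<phi>1 :: "'x word \<Rightarrow> nat" and \<phi>2 :: "'x word \<Rightarrow> 'y" where
  query1:
    "(\<sigma>, a, None, None) \<in> omega_query1 A \<Longrightarrow>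
     omega_move A z \<phi>1 \<phi>2 (\<sigma>, a, None, None)
       (\<sigma>, a, Some (\<phi>1 (omega_query_arg A z \<sigma> a)), None)"
| query2:
    "(\<sigma>, a, Some n, None :: 'y option) \<in> omega_query2 \<Longrightarrow>
     omega_move A z \<phi>1 \<phi>2 (\<sigma>, a, Some n, None)
       (\<sigma>, a, Some n, Some (\<phi>2 (omega_query_arg A z \<sigma> a)))"
| trans:
    "s \<notin> omega_query1 A \<Longrightarrow> s \<notin> omega_query2 \<Longrightarrow> omega_trans A s s' \<Longrightarrow>
     omega_move A z \<phi>1 \<phi>2 s s'"

definition omega_reachable :: "('x list, 'x, 'y, 'r) algorithm \<Rightarrow> 'x \<Rightarrow>
    ('x word \<Rightarrow> nat) \<Rightarrow> ('x word \<Rightarrow> 'y) \<Rightarrow> ('x, 'y, 'r) omega_state \<Rightarrow> bool" where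
  "omega_reachable A z \<phi>1 \<phi>2 s \<longleftrightarrow>
     reachable (omega_move A z \<phi>1 \<phi>2) omega_end (omega_init A) s"

definition F1 :: "'x \<Rightarrow> ('x word \<Rightarrow> nat) set" where
  "F1 z = {\<phi>. \<forall>\<gamma>. \<exists>N. \<phi> (prefix N \<gamma> \<frown> (\<lambda>_. z)) < N}"

end

theory Submission
  imports Defs
begin

text \<open>
  A call of \<open>A\<close> on the argument \<open>s\<close> is run on top of a stack \<open>\<sigma>\<close> with \<open>\<xi>\<^sup>*(\<sigma>) = s\<close>, and its
  result depends on \<open>s\<close> only.  If every nested call on \<open>s @ [x]\<close> that may be opened returns,
  then the values delivered to the call on \<open>s\<close> form a total oracle \<open>f\<close>, so that call returns
  because \<open>A\<close> terminates on \<open>f\<close>.  Hence, if the call on \<open>[]\<close> did not return,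
  dependent choice would yield a sequence \<open>\<gamma>\<close> all of whose prefixes \<open>s\<close> satisfy
  \<open>\<phi>\<^sub>1(s :: 0) \<ge> |s|\<close>, contradicting \<open>\<phi>\<^sub>1 \<in> F\<^sub>1\<close>.
\<close>

abbreviation steps :: "('s \<Rightarrow> 's \<Rightarrow> bool) \<Rightarrow> 's set \<Rightarrow> 's \<Rightarrow> 's \<Rightarrow> bool" where
  "steps mv F \<equiv> (\<lambda>s t. s \<notin> F \<and> mv s t)\<^sup>*\<^sup>*"

text \<open>Runs become a reflexive transitive closure, so that they can be concatenated and used
  for induction. Only the source of each step must avoid \<open>F\<close>, since a run may end in
  \<open>F\<close>.\<close>

lemma reachable_iff_steps: "reachable mv F s t \<longleftrightarrow> steps mv F s t"
proof
  assume "reachable mv F s t"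
  then obtain ss where ss: "ss \<noteq> []" "hd ss = s" "last ss = t"
      "\<And>i. Suc i < length ss \<Longrightarrow> ss ! i \<notin> F \<and> mv (ss ! i) (ss ! Suc i)"
    unfolding reachable_def run_def by blast
  have "((\<lambda>s t. s \<notin> F \<and> mv s t) ^^ (length ss - 1)) s t"
    unfolding relpowp_fun_conv
    by (rule exI[of _ "(!) ss"]) (use ss in \<open>auto simp: hd_conv_nth last_conv_nth\<close>)
  then show "steps mv F s t"
    by (rule relpowp_imp_rtranclp)
next
  assume "steps mv F s t"
  then obtain n f where f: "f 0 = s" "f n = t"
      "\<And>i. i < n \<Longrightarrow> f i \<notin> F \<and> mv (f i) (f (Suc i))"
    unfolding rtranclp_power relpowp_fun_conv by blast
  have "run mv F (map f [0..<Suc n])"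
    unfolding run_def using f(3) by (auto simp del: upt_Suc)
  moreover have "hd (map f [0..<Suc n]) = s" "last (map f [0..<Suc n]) = t"
    using f(1,2) by (simp_all add: hd_map del: upt_Suc) simp
  ultimately show "reachable mv F s t"
    unfolding reachable_def by blast
qed

lemma infinite_branch:
  assumes "P []" and "\<And>s. P s \<Longrightarrow> \<exists>x. P (s @ [x])"
  shows "\<exists>\<gamma>. \<forall>n. P (prefix n \<gamma>)"
proof -
  \<comment> \<open>The length condition forces \<open>f 0 = []\<close>, so that \<open>f n\<close>
    consists exactly of the first \<open>n\<close> appended elements.\<close>
  have "\<exists>f. \<forall>n. (P (f n) \<and> length (f n) = n) \<and> (\<exists>x. f (Suc n) = f n @ [x])"
    by (rule dependent_nat_choice) (use assms in fastforce)+
  then obtain f where f: "\<And>n. P (f n)" "\<And>n. length (f n) = n" "\<And>n. \<exists>x. f (Suc n) = f n @ [x]"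
    by blast
  have "prefix n (\<lambda>k. last (f (Suc k))) = f n" for n
  proof (induction n)
    case 0
    then show ?case using f(2)[of 0] by simp
  next
    case (Suc n)
    then show ?case using f(3)[of n] by auto
  qed
  then show ?thesis using f(1) by metis
qed

context
  fixes A :: "('x list, 'x, 'y, 'r) algorithm" and z :: 'x
    and \<phi>1 :: "'x word \<Rightarrow> nat" and \<phi>2 :: "'x word \<Rightarrow> 'y"
begin

abbreviation omega_steps where
  "omega_steps \<equiv> steps (omega_move A z \<phi>1 \<phi>2) omega_end"

text \<open>The outcome is fixed before the stack is chosen: the value \<open>y\<close> is to serve
  as an oracle answer, so it must not depend on which stack represents \<open>s\<close>.\<close>

definition call_returns :: "'x list \<Rightarrow> 'x list \<Rightarrow> nat \<Rightarrow> 'y \<Rightarrow> bool" where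
  "call_returns s a n y \<longleftrightarrow> (\<forall>\<sigma>. map (query_arg A) \<sigma> = s \<longrightarrow>
     omega_steps (\<sigma> @ [init A s], [], None, None) (\<sigma>, a, Some n, Some y))"

text \<open>End states have an empty stack, so a state with a frame on top is never final.\<close>

lemma omega_steps_transI:
  assumes "omega_steps s (\<sigma> @ [r], a, oo)"
    and "omega_trans A (\<sigma> @ [r], a, oo) t"
    and "(\<sigma> @ [r], a, oo) \<notin> omega_query1 A" "(\<sigma> @ [r], a, oo) \<notin> omega_query2"
  shows "omega_steps s t"
proof (rule rtranclp.rtrancl_into_rtrancl[OF assms(1)])
  show "(\<sigma> @ [r], a, oo) \<notin> omega_end \<and> omega_move A z \<phi>1 \<phi>2 (\<sigma> @ [r], a, oo) t"
    using omega_move.trans[OF assms(3,4,2)] by (auto simp: omega_end_def)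
qed

text \<open>Either way the query of the top frame receives a value. If \<open>\<phi>1\<close> stays
  below the stack height, \<open>\<phi>2\<close> supplies it; otherwise \<open>call\<close> opens a
  frame for \<open>s\<close>, and its return leaves \<open>a\<close>, \<open>n\<close> and
  \<open>y\<close> for the frame \<open>r\<close>.\<close>

lemma query_answered:
  fixes \<sigma> :: "'r list" and r :: 'r
  defines "s \<equiv> map (query_arg A) (\<sigma> @ [r])"
  assumes query: "(r, None) \<in> query_states A"
  shows "\<phi>1 (s \<frown> (\<lambda>_. z)) < length s \<Longrightarrow>
      omega_steps (\<sigma> @ [r], [], None, None)
        (\<sigma> @ [r], [], Some (\<phi>1 (s \<frown> (\<lambda>_. z))), Some (\<phi>2 (s \<frown> (\<lambda>_. z))))"
    and "\<not> \<phi>1 (s \<frown> (\<lambda>_. z)) < length s \<Longrightarrow> call_returns s a n y \<Longrightarrow>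
      omega_steps (\<sigma> @ [r], [], None, None) (\<sigma> @ [r], a, Some n, Some y)"
proof -
  let ?n = "\<phi>1 (s \<frown> (\<lambda>_. z))"
  have arg: "omega_query_arg A z (\<sigma> @ [r]) [] = s \<frown> (\<lambda>_. z)"
    by (simp add: omega_query_arg_def s_def)
  have "omega_move A z \<phi>1 \<phi>2 (\<sigma> @ [r], [], None, None) (\<sigma> @ [r], [], Some ?n, None)"
    unfolding arg[symmetric]
    by (rule omega_move.query1) (use query in \<open>auto simp: omega_query1_def\<close>)
  then have q1: "omega_steps (\<sigma> @ [r], [], None, None) (\<sigma> @ [r], [], Some ?n, None)"
    by (auto simp: omega_end_def)
  { assume "?n < length s"
    then have "omega_move A z \<phi>1 \<phi>2 (\<sigma> @ [r], [], Some ?n, None)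
        (\<sigma> @ [r], [], Some ?n, Some (\<phi>2 (omega_query_arg A z (\<sigma> @ [r]) [])))"
      by (intro omega_move.query2) (auto simp: omega_query2_def s_def)
    then show "omega_steps (\<sigma> @ [r], [], None, None)
        (\<sigma> @ [r], [], Some ?n, Some (\<phi>2 (s \<frown> (\<lambda>_. z))))"
      using q1 unfolding arg
      by (elim rtranclp.rtrancl_into_rtrancl) (auto simp: omega_end_def) }
  { assume "\<not> ?n < length s" and ret: "call_returns s a n y"
    then have "omega_steps (\<sigma> @ [r], [], None, None)
        ((\<sigma> @ [r]) @ [init A s], [], None, None)"
      using omega_trans.call[of A "\<sigma> @ [r]" ?n]
      by (intro omega_steps_transI[OF q1])
        (auto simp: omega_query1_def omega_query2_def s_def)
    also have "omega_steps \<dots> (\<sigma> @ [r], a, Some n, Some y)"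
      using ret unfolding call_returns_def s_def by blast
    finally show "omega_steps (\<sigma> @ [r], [], None, None) (\<sigma> @ [r], a, Some n, Some y)" . }
qed

text \<open>Invariant along a run of \<open>A\<close> on an oracle: the top frame mirrors the state
  of \<open>A\<close>, on every stack representing \<open>s\<close>. As in
  \<open>call_returns\<close>, \<open>a\<close> and \<open>n\<close> are independent of the
  stack.\<close>

fun simulated :: "'x list \<Rightarrow> ('r, 'y) state \<Rightarrow> bool" where
  "simulated s (r, None) \<longleftrightarrow> (\<forall>\<sigma>. map (query_arg A) \<sigma> = s \<longrightarrow>
     omega_steps (\<sigma> @ [init A s], [], None, None) (\<sigma> @ [r], [], None, None))"
| "simulated s (r, Some y) \<longleftrightarrow> (\<exists>a n. \<forall>\<sigma>. map (query_arg A) \<sigma> = s \<longrightarrow>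
     omega_steps (\<sigma> @ [init A s], [], None, None) (\<sigma> @ [r], a, Some n, Some y))"

lemma simulated_trans:
  assumes alg: "approximation_algorithm A"
    and sim: "simulated s p" and p: "p \<notin> end_states A" "p \<notin> query_states A"
    and tr: "trans_fun A p = Some p'"
  shows "simulated s p'"
proof -
  obtain r oo r' oo' where [simp]: "p = (r, oo)" "p' = (r', oo')"
    by fastforce
  \<comment> \<open>A transition never creates or changes an answer; the remaining cases are those
    of \<open>step_open\<close>, \<open>step_reset\<close> and \<open>step_closed\<close>.\<close>
  have keep: "oo = Some y" if "oo' = Some y" for y
    using alg tr that unfolding approximation_algorithm_def by auto
  show ?thesis
  proof (cases oo)
    case None
    with keep have [simp]: "oo' = None" by (cases oo') auto
    have "omega_steps (\<sigma> @ [init A s], [], None, None) (\<sigma> @ [r'], [], None, None)"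
      if "map (query_arg A) \<sigma> = s" for \<sigma>
    proof (rule omega_steps_transI)
      show "omega_steps (\<sigma> @ [init A s], [], None, None) (\<sigma> @ [r], [], None, None)"
        using sim None that by simp
      show "omega_trans A (\<sigma> @ [r], [], None, None) (\<sigma> @ [r'], [], None, None)"
        using tr None by (intro omega_trans.step_open) simp
    qed (use p None in \<open>auto simp: omega_query1_def omega_query2_def\<close>)
    then show ?thesis by simp
  next
    case (Some y)
    with sim obtain a n where an: "\<And>\<sigma>. map (query_arg A) \<sigma> = s \<Longrightarrow>
        omega_steps (\<sigma> @ [init A s], [], None, None) (\<sigma> @ [r], a, Some n, Some y)"
      by auto
    show ?thesis
    proof (cases oo')
      case None
      have "omega_steps (\<sigma> @ [init A s], [], None, None) (\<sigma> @ [r'], [], None, None)"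
        if "map (query_arg A) \<sigma> = s" for \<sigma>
        by (rule omega_steps_transI[OF an[OF that]], rule omega_trans.step_reset)
          (use p tr Some None in \<open>auto simp: omega_query1_def omega_query2_def\<close>)
      then show ?thesis using None by simp
    next
      case (Some y')
      with keep \<open>oo = Some y\<close> have [simp]: "oo' = Some y" by simp
      have "omega_steps (\<sigma> @ [init A s], [], None, None) (\<sigma> @ [r'], a, Some n, Some y)"
        if "map (query_arg A) \<sigma> = s" for \<sigma>
        by (rule omega_steps_transI[OF an[OF that]], rule omega_trans.step_closed)
          (use p tr \<open>oo = Some y\<close> in \<open>auto simp: omega_query1_def omega_query2_def\<close>)
      then show ?thesis by auto
    qed
  qed
qed

lemma call_returns_step:
  assumes alg: "approximation_algorithm A" and "terminates A"
    and nested: "\<And>x. \<not> \<phi>1 ((s @ [x]) \<frown> (\<lambda>_. z)) < length (s @ [x]) \<Longrightarrow>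
      \<exists>a n y. call_returns (s @ [x]) a n y"
  shows "\<exists>a n y. call_returns s a n y"
proof -
  have "\<exists>y. (if \<phi>1 ((s @ [x]) \<frown> (\<lambda>_. z)) < length (s @ [x])
      then y = \<phi>2 ((s @ [x]) \<frown> (\<lambda>_. z)) else \<exists>a n. call_returns (s @ [x]) a n y)" for x
    using nested[of x] by auto
  \<comment> \<open>Choice makes the answers to all possible queries into one total oracle, to which
    termination of \<open>A\<close> applies.\<close>
  then obtain f where f: "\<And>x. if \<phi>1 ((s @ [x]) \<frown> (\<lambda>_. z)) < length (s @ [x])
      then f x = \<phi>2 ((s @ [x]) \<frown> (\<lambda>_. z)) else \<exists>a n. call_returns (s @ [x]) a n (f x)"
    by metis
  have query: "simulated s (r, Some (f (query_arg A r)))"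
    if sim: "simulated s (r, None)" and q: "(r, None) \<in> query_states A" for r
  proof -
    have "\<exists>a n. \<forall>\<sigma>. map (query_arg A) \<sigma> = s \<longrightarrow>
        omega_steps (\<sigma> @ [r], [], None, None)
          (\<sigma> @ [r], a, Some n, Some (f (query_arg A r)))"
    proof (cases "\<phi>1 ((s @ [query_arg A r]) \<frown> (\<lambda>_. z)) < length (s @ [query_arg A r])")
      case True
      then have "f (query_arg A r) = \<phi>2 ((s @ [query_arg A r]) \<frown> (\<lambda>_. z))"
        using f[of "query_arg A r"] by simp
      with True have "omega_steps (\<sigma> @ [r], [], None, None)
          (\<sigma> @ [r], [], Some (\<phi>1 ((s @ [query_arg A r]) \<frown> (\<lambda>_. z))), Some (f (query_arg A r)))"
        if "map (query_arg A) \<sigma> = s" for \<sigma>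
        using query_answered(1)[OF q, of \<sigma>] that by simp
      then show ?thesis by blast
    next
      case False
      then obtain a n where "call_returns (s @ [query_arg A r]) a n (f (query_arg A r))"
        using f[of "query_arg A r"] by auto
      with False have "omega_steps (\<sigma> @ [r], [], None, None)
          (\<sigma> @ [r], a, Some n, Some (f (query_arg A r)))"
        if "map (query_arg A) \<sigma> = s" for \<sigma>
        using query_answered(2)[OF q, of \<sigma>] that by simp
      then show ?thesis by blast
    qed
    with sim show ?thesis
      by simp (meson rtranclp_trans)
  qed
  obtain t where t: "t \<in> end_states A"
      and "steps (move A f) (end_states A) (init A s, None) t"
    using \<open>terminates A\<close> unfolding terminates_def reachable_iff_steps by blast
  \<comment> \<open>Induction along the run of \<open>A\<close> on \<open>f\<close>:
    \<open>query\<close> handles oracle moves and \<open>simulated_trans\<close> all others.\<close>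
  from this(2) have "simulated s t"
  proof (induction rule: rtranclp_induct)
    case base
    show ?case by simp
  next
    case (step p p')
    from step(2) have "p \<notin> end_states A" "move A f p p'" by auto
    from this(2) this(1) step(3) show ?case
      by cases (blast intro: query simulated_trans[OF alg])+
  qed
  moreover obtain r y where ry: "t = (r, Some y)"
    using t alg unfolding approximation_algorithm_def by blast
  ultimately obtain a n where "\<And>\<sigma>. map (query_arg A) \<sigma> = s \<Longrightarrow>
      omega_steps (\<sigma> @ [init A s], [], None, None) (\<sigma> @ [r], a, Some n, Some y)"
    by auto
  \<comment> \<open>Since \<open>t\<close> is an end state, \<open>return\<close> pops its frame and
    moves its \<open>query_arg\<close> to the front of \<open>a\<close>.\<close>
  then have "call_returns s (query_arg A r # a) n y"
    unfolding call_returns_def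
    by (intro allI impI, rule omega_steps_transI, blast, intro omega_trans.return)
      (use t ry in \<open>auto simp: omega_query1_def omega_query2_def\<close>)
  then show ?thesis by blast
qed

lemma empty_call_returns:
  assumes "approximation_algorithm A" "terminates A" "\<phi>1 \<in> F1 z"
  shows "\<exists>a n y. call_returns [] a n y"
proof (rule ccontr)
  \<comment> \<open>The second conjunct is the condition under which a call on \<open>s\<close> is
    opened; it is trivial for \<open>[]\<close>. By contraposition, \<open>call_returns_step\<close>
    extends any \<open>s\<close> with \<open>?P s\<close> by one element.\<close>
  let ?P = "\<lambda>s. (\<nexists>a n y. call_returns s a n y) \<and> length s \<le> \<phi>1 (s \<frown> (\<lambda>_. z))"
  assume "\<nexists>a n y. call_returns [] a n y"
  moreover have "\<exists>x. ?P (s @ [x])" if "?P s" for s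
    using call_returns_step[OF assms(1,2), of s] that by (metis (no_types, lifting) not_less)
  ultimately obtain \<gamma> where "\<And>n. ?P (prefix n \<gamma>)"
    using infinite_branch[of ?P] by auto
  then have "length (prefix N \<gamma>) \<le> \<phi>1 (prefix N \<gamma> \<frown> (\<lambda>_. z))" for N
    by blast
  then have "\<not> \<phi>1 (prefix N \<gamma> \<frown> (\<lambda>_. z)) < N" for N
    by (simp add: not_less)
  with assms(3) show False
    unfolding F1_def by blast
qed

end

theorem theorem5p13:
  fixes z :: 'x
    and A :: "('x list, 'x, 'y, 'r) algorithm"
  assumes "approximation_algorithm A"
    and "terminates A"
  shows "\<forall>\<phi>1 \<in> F1 z. \<forall>\<phi>2 :: 'x word \<Rightarrow> 'y.
           \<exists>s \<in> omega_end. omega_reachable A z \<phi>1 \<phi>2 s"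
proof (intro ballI allI)
  fix \<phi>1 :: "'x word \<Rightarrow> nat" and \<phi>2 :: "'x word \<Rightarrow> 'y"
  assume "\<phi>1 \<in> F1 z"
  then obtain a n y where "call_returns A z \<phi>1 \<phi>2 [] a n y"
    using empty_call_returns[OF assms] by blast
  \<comment> \<open>Take the empty stack in \<open>call_returns\<close>: the initial state is the
    call on \<open>[]\<close>, and its return leaves no frame.\<close>
  then have "omega_reachable A z \<phi>1 \<phi>2 ([], a, Some n, Some y)"
    unfolding call_returns_def omega_reachable_def omega_init_def reachable_iff_steps by simp
  then show "\<exists>s \<in> omega_end. omega_reachable A z \<phi>1 \<phi>2 s"
    unfolding omega_end_def by blast
qed

end
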